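(* Fix any integer $\ell \ge 2$ and let $d = 2^{\ell-1} + 2^{\ell-2}$. For $n \ge 1$, let $S_{2^\ell}:\{0,1\}^n \to \{0,1\}$ be the elementary symmetric polynomial of degree $2^\ell$ over $\mathbb{F}_2$, i.e. $S_{2^\ell}(x) = \binom{|x|}{2^\ell} \bmod 2$. Then $$\gamma_{d,3}(S_{2^\ell}) \ge \frac{9}{16} - o(1),$$ where $o(1)$ denotes a quantity (depending on $\ell$ and $n$) that tends to $0$ as $n \to \infty$.
   Context: For $x\in\{0,1\}^n$, $|x|$ is its Hamming weight. For a Boolean function $F:\{0,1\}^n\to\{0,1\}$ and $k\ge 1$, the $k$-lift of $F$ is $F_k:\{0,1\}^n\to \mathbb{Z}/2^k\mathbb{Z}$ with $F_k(x)=0$ if $F(x)=0$ and $F_k(x)=2^{k-1}$ if $F(x)=1$. $\mathcal{P}_{d,k}$ denotes the set of multilinear polynomials in $x_1,\dots,x_n$ of degree at most $d$ with coefficients in $\mathbb{Z}/2^k\mathbb{Z}$, evaluated on $\{0,1\}^n$. For functions $F,G$ on a finite domain $D$, $\mathrm{agr}(F,G)=\Pr_{x\sim D}[F(x)=G(x)]$ with $x$ uniform. Finally $\gamma_{d,k}(F)=\max_{Q\in\mathcal{P}_{d,k}}\mathrm{agr}(F_k,Q)$. *)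

theory Defs
  imports "HOL-Probability.Probability"
begin

definition cube :: "nat \<Rightarrow> (nat \<Rightarrow> nat) set" where
  "cube n = (\<Pi>\<^sub>E i\<in>{1..n}. {0, 1})"

definition hamming_weight :: "nat \<Rightarrow> (nat \<Rightarrow> nat) \<Rightarrow> nat" where
  "hamming_weight n x = (\<Sum>i=1..n. x i)"

text \<open>The ring $\mathbb{Z}/2^k\mathbb{Z}$ is represented throughout by the residues
  \<open>{0..<2 ^ k}\<close> of type \<open>int\<close>.\<close>

definition lift :: "nat \<Rightarrow> ('a \<Rightarrow> nat) \<Rightarrow> 'a \<Rightarrow> int" where
  "lift k F x = (if F x = 0 then 0 else 2 ^ (k - 1))"

text \<open>A multilinear polynomial is given by a coefficient \<open>c I\<close> for each monomial
  \<open>\<Prod>i\<in>I. x i\<close>, where \<open>I\<close> is a set of variable indices; the members of \<open>mpolys n d k\<close> are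
  the evaluation maps.\<close>

definition mpolys :: "nat \<Rightarrow> nat \<Rightarrow> nat \<Rightarrow> ((nat \<Rightarrow> nat) \<Rightarrow> int) set" where
  "mpolys n d k =
     {\<lambda>x. (\<Sum>I | I \<subseteq> {1..n} \<and> card I \<le> d. c I * (\<Prod>i\<in>I. int (x i))) mod 2 ^ k
      | c :: nat set \<Rightarrow> int. \<forall>I. c I \<in> {0..<2 ^ k}}"

definition agr :: "'a set \<Rightarrow> ('a \<Rightarrow> 'b) \<Rightarrow> ('a \<Rightarrow> 'b) \<Rightarrow> real" where
  "agr D F G = measure_pmf.prob (pmf_of_set D) {x. F x = G x}"

definition gamma :: "nat \<Rightarrow> nat \<Rightarrow> nat \<Rightarrow> ((nat \<Rightarrow> nat) \<Rightarrow> nat) \<Rightarrow> real" where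
  "gamma n d k F = Max ((\<lambda>Q. agr (cube n) (lift k F) Q) ` mpolys n d k)"

definition elem_sym :: "nat \<Rightarrow> nat \<Rightarrow> (nat \<Rightarrow> nat) \<Rightarrow> nat" where
  "elem_sym n m x = (\<Sum>I | I \<subseteq> {1..n} \<and> card I = m. \<Prod>i\<in>I. x i) mod 2"

lemma elem_sym_eq_binomial:
  assumes "x \<in> cube n"
  shows "elem_sym n m x = (hamming_weight n x choose m) mod 2"
proof -
  define A where "A = {i\<in>{1..n}. x i = 1}"
  have x: "x i = (if i \<in> A then 1 else 0)" if "i \<in> {1..n}" for i
    using assms that by (force simp: cube_def A_def PiE_iff)
  have A: "A \<subseteq> {1..n}" "finite A" by (auto simp: A_def)
  have "hamming_weight n x = (\<Sum>i=1..n. if i \<in> A then 1 else 0)"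
    unfolding hamming_weight_def by (intro sum.cong refl x)
  also have "\<dots> = card A"
    using A by (simp add: sum.If_cases Int_absorb1)
  finally have w: "hamming_weight n x = card A" .
  have p: "(\<Prod>i\<in>I. x i) = (if I \<subseteq> A then 1 else 0)" if "I \<subseteq> {1..n}" for I
  proof (cases "I \<subseteq> A")
    case True
    have "(\<Prod>i\<in>I. x i) = 1"
      using True that x by (intro prod.neutral) (metis subsetD)
    then show ?thesis using True by simp
  next
    case False
    then obtain i where "i \<in> I" "i \<notin> A" by blast
    moreover have "finite I" using that finite_subset by blast
    moreover have "x i = 0" using x[of i] that \<open>i \<in> I\<close> \<open>i \<notin> A\<close> by (metis subsetD)
    ultimately have "(\<Prod>i\<in>I. x i) = 0" by (intro prod_zero) auto
    then show ?thesis using False by simp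
  qed
  have "(\<Sum>I | I \<subseteq> {1..n} \<and> card I = m. \<Prod>i\<in>I. x i)
      = (\<Sum>I | I \<subseteq> {1..n} \<and> card I = m. if I \<subseteq> A then 1 else 0)"
    by (intro sum.cong refl p) auto
  also have "\<dots> = card ({I. I \<subseteq> {1..n} \<and> card I = m} \<inter> {I. I \<subseteq> A})"
    by (simp add: sum.If_cases)
  also have "{I. I \<subseteq> {1..n} \<and> card I = m} \<inter> {I. I \<subseteq> A} = {I. I \<subseteq> A \<and> card I = m}"
    using A by auto
  also have "card \<dots> = card A choose m" using A by (simp add: n_subsets)
  finally show ?thesis by (simp add: elem_sym_def w)
qed

lemma finite_cube: "finite (cube n)" and cube_nonempty: "cube n \<noteq> {}"
  by (auto simp: cube_def PiE_eq_empty_iff intro!: finite_PiE)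

text \<open>The maximum defining \<open>gamma\<close> is taken over a finite nonempty set.\<close>

lemma gamma_max_well_defined:
  "finite ((\<lambda>Q. agr (cube n) (lift k F) Q) ` mpolys n d k)"
  "(\<lambda>Q. agr (cube n) (lift k F) Q) ` mpolys n d k \<noteq> {}"
proof -
  have "(\<lambda>Q. agr (cube n) (lift k F) Q) ` mpolys n d k
      \<subseteq> (\<lambda>B. real (card B) / real (card (cube n))) ` Pow (cube n)"
    by (auto simp: agr_def measure_pmf_of_set finite_cube cube_nonempty)
  then show "finite ((\<lambda>Q. agr (cube n) (lift k F) Q) ` mpolys n d k)"
    by (rule finite_subset) (simp add: finite_cube)
  have "\<exists>c :: nat set \<Rightarrow> int. \<forall>I. c I \<in> {0..<2 ^ k}"
    by (rule exI[of _ "\<lambda>_. 0"]) simp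
  then show "(\<lambda>Q. agr (cube n) (lift k F) Q) ` mpolys n d k \<noteq> {}"
    unfolding mpolys_def by blast
qed

end

theory Submission
  imports Defs "HOL-Library.Real_Mod"
begin

text \<open>
  Put \<open>m = 2 ^ (l - 2)\<close>, so \<open>d = 3 * m\<close>. The approximating polynomial is the elementary symmetric
  polynomial of degree \<open>d\<close> with coefficients modulo 8, whose value at a point of weight \<open>w\<close> is
  \<open>w choose (3 * m)\<close>. The 2-adic valuation of \<open>w choose (m * k)\<close> equals that of \<open>q choose k\<close> for
  \<open>q = w div m\<close>, because \<open>m\<close> is a power of 2. Hence \<open>w choose (4 * m)\<close> has the parity of
  \<open>q div 4\<close>, and \<open>w choose (3 * m)\<close> is 4 or 0 modulo 8 according to this parity whenever
  \<open>q choose 3\<close> is. The latter holds for \<open>q\<close> even and for \<open>q\<close> congruent to 1 modulo 16, that is,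
  for 9 of the 16 residues. Since \<open>\<Sum>x. z ^ |x| = (1 + z) ^ n\<close> is \<open>o(2 ^ n)\<close> at every root of
  unity \<open>z \<noteq> 1\<close>, the weight is asymptotically equidistributed modulo \<open>16 * m\<close>.
\<close>

section \<open>2-adic valuations of binomial coefficients\<close>

text \<open>This is the double factorial (2n - 1)!!, the product of the odd factors of
  (2n)!.\<close>

definition odd_fact :: "nat \<Rightarrow> nat" where
  "odd_fact n = (\<Prod>i<n. 2 * i + 1)"

lemma odd_odd_fact: "odd (odd_fact n)"
  by (induction n) (auto simp: odd_fact_def)

lemma fact_double: "fact (2 * n) = 2 ^ n * fact n * odd_fact n"
  by (induction n) (simp_all add: odd_fact_def algebra_simps)

text \<open>Splitting each of the factorials (2a)!, (2k)! and (2(a - k))! by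
  \<open>fact_double\<close>, the powers of 2 cancel because k + (a - k) = a. The product form
  avoids division in \<open>nat\<close>.\<close>

lemma choose_double:
  assumes "k \<le> a"
  shows "odd_fact k * odd_fact (a - k) * (2 * a choose (2 * k)) = odd_fact a * (a choose k)"
proof -
  define b where "b = a - k"
  have a: "a = k + b"
    using assms by (simp add: b_def)
  let ?c = "2 ^ a * fact k * fact b :: nat"
  have "?c * (odd_fact k * odd_fact b * (2 * a choose (2 * k)))
      = fact (2 * k) * fact (2 * b) * (2 * a choose (2 * k))"
    by (simp only: fact_double) (simp add: a power_add mult_ac)
  also have "\<dots> = fact (2 * a)"
    using binomial_fact_lemma[of "2 * k" "2 * a"] by (simp add: a algebra_simps)
  also have "\<dots> = 2 ^ a * odd_fact a * (fact k * fact b * (a choose k))"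
    using binomial_fact_lemma[of k a] by (simp only: fact_double) (simp add: a)
  also have "\<dots> = ?c * (odd_fact a * (a choose k))"
    by (simp add: algebra_simps)
  finally show ?thesis
    by (simp add: b_def)
qed

text \<open>Odd cofactors express equality of 2-adic valuations without division, and they also
  cover the case where both binomials vanish.\<close>

lemma choose_double_right:
  "\<exists>u v. odd u \<and> odd v \<and> u * (n choose (2 * k)) = v * (n div 2 choose k)"
proof (cases "k \<le> n div 2")
  case False
  then have "n choose (2 * k) = 0" "n div 2 choose k = 0"
    by (auto intro!: binomial_eq_0)
  then show ?thesis
    by (intro exI[of _ 1]) (simp only: odd_one mult_0_right simp_thms)
next
  case True
  define a where "a = n div 2"
  let ?u = "odd_fact k * odd_fact (a - k)"
  have u: "odd ?u" "?u * (2 * a choose (2 * k)) = odd_fact a * (a choose k)"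
    using True choose_double[of k a] by (auto simp: odd_odd_fact a_def)
  show ?thesis
  proof (cases "even n")
    case True
    then have "n = 2 * a"
      by (simp add: a_def)
    with u show ?thesis
      by (intro exI[of _ ?u] exI[of _ "odd_fact a"]) (simp add: odd_odd_fact)
  next
    case False
    then have n: "n = 2 * a + 1"
      by (simp add: a_def)
    have odd: "odd (n - 2 * k)"
      using True by (simp add: n)
    \<comment> \<open>Absorption passes from \<open>n\<close> to the even number
      \<open>n - 1\<close>; both factors it introduces are odd.\<close>
    have "(n - 2 * k) * (n choose (2 * k)) = n * (2 * a choose (2 * k))"
      using binomial_absorb_comp[of n "2 * k"] by (simp add: n)
    then have "?u * (n - 2 * k) * (n choose (2 * k)) = n * (?u * (2 * a choose (2 * k)))"
      by (simp only: mult_ac)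
    also have "\<dots> = n * odd_fact a * (a choose k)"
      by (simp add: u(2))
    finally show ?thesis
      using u(1) odd False by (intro exI[of _ "?u * (n - 2 * k)"] exI[of _ "n * odd_fact a"])
        (simp add: odd_odd_fact a_def)
  qed
qed

lemma choose_pow2_mult_right:
  "\<exists>u v. odd u \<and> odd v \<and> u * (n choose (2 ^ s * k)) = v * (n div 2 ^ s choose k)"
proof (induction s arbitrary: n)
  case 0
  show ?case
    by (intro exI[of _ 1]) simp
next
  case (Suc s)
  obtain u v where uv: "odd u" "odd v"
    "u * (n choose (2 * (2 ^ s * k))) = v * (n div 2 choose (2 ^ s * k))"
    using choose_double_right by blast
  obtain u' v' where uv': "odd u'" "odd v'"
    "u' * (n div 2 choose (2 ^ s * k)) = v' * (n div 2 div 2 ^ s choose k)"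
    using Suc.IH by blast
  have "u' * u * (n choose (2 * (2 ^ s * k))) = v * (u' * (n div 2 choose (2 ^ s * k)))"
    using uv(3) by (simp add: algebra_simps)
  also have "\<dots> = v * v' * (n div 2 div 2 ^ s choose k)"
    by (simp add: uv'(3))
  finally show ?case
    using uv(1,2) uv'(1,2)
    by (intro exI[of _ "u' * u"] exI[of _ "v * v'"]) (simp add: div_mult2_eq mult.assoc)
qed

lemma odd_choose_pow2_mult_right:
  "odd (n choose (2 ^ s * k)) \<longleftrightarrow> odd (n div 2 ^ s choose k)"
proof -
  obtain u v where "odd u" "odd v" "u * (n choose (2 ^ s * k)) = v * (n div 2 ^ s choose k)"
    using choose_pow2_mult_right by blast
  then show ?thesis
    by (metis even_mult_iff)
qed

text \<open>An odd factor fixes the classes of 0 and 4 modulo 8, so the unknown cofactors do no harm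
  once 4 divides the binomial.\<close>

lemma choose_pow2_mult_right_mod8:
  assumes "4 dvd (n div 2 ^ s choose k)"
  shows "(n choose (2 ^ s * k)) mod 8 = (n div 2 ^ s choose k) mod 8"
proof -
  obtain u v where uv: "odd u" "odd v"
    "u * (n choose (2 ^ s * k)) = v * (n div 2 ^ s choose k)"
    using choose_pow2_mult_right by blast
  have "coprime (2 ^ 2) u"
    using uv(1) by (simp only: coprime_power_left_iff) simp
  moreover have "4 dvd u * (n choose (2 ^ s * k))"
    using assms uv(3) by simp
  ultimately have "4 dvd (n choose (2 ^ s * k))"
    by (simp add: coprime_dvd_mult_right_iff)
  then obtain x y where xy: "n choose (2 ^ s * k) = 4 * x" "n div 2 ^ s choose k = 4 * y"
    using assms by (auto elim!: dvdE)
  then have "u * x = v * y"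
    using uv(3) by simp
  then have "even x \<longleftrightarrow> even y"
    using uv(1,2) by (metis even_mult_iff)
  then show ?thesis
    unfolding xy by presburger
qed

text \<open>If q = 2p, then 3 times \<open>q choose 3\<close> is 4 (2p - 1) times
  \<open>p choose 2\<close>, whose parity is that of p div 2 = q div 4. If q = 16t + 1, the factor q
  - 1 makes \<open>q choose 3\<close> divisible by 8, and q div 4 = 4t is even.\<close>

lemma choose_3_mod8:
  assumes "even q \<or> q mod 16 = 1"
  shows "(q choose 3) mod 8 = (if odd (q choose 4) then 4 else 0)"
proof -
  define B where "B = q choose 3"
  define C where "C = (q - 1) choose 2"
  have B: "3 * B = q * C"
    using binomial_absorption[of 2 q] by (simp add: B_def C_def numeral_3_eq_3 numeral_2_eq_2)
  have C: "2 * C = (q - 1) * (q - 2)"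
    using binomial_absorption[of 1 "q - 1"] by (simp add: C_def numeral_2_eq_2)
  have par: "odd (q choose 4) \<longleftrightarrow> odd (q div 4)"
    using odd_choose_pow2_mult_right[of q 2 1] by simp
  have "B mod 8 = (if odd (q div 4) then 4 else 0)"
  proof (cases "even q")
    case True
    then obtain p where q: "q = 2 * p"
      by (elim evenE)
    define D where "D = p choose 2"
    have D: "2 * D = p * (p - 1)"
      using binomial_absorption[of 1 p] by (simp add: D_def numeral_2_eq_2)
    have parD: "odd D \<longleftrightarrow> odd (p div 2)"
      using odd_choose_pow2_mult_right[of p 1 1] by (simp add: D_def)
    define E where "E = D * (2 * p - 1)"
    have "C = (2 * p - 1) * (p - 1)"
    proof -
      have "q - 2 = 2 * (p - 1)" "q - 1 = 2 * p - 1"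
        by (simp_all add: q diff_mult_distrib2)
      with C show ?thesis
        by simp
    qed
    then have "3 * B = 2 * (p * (p - 1)) * (2 * p - 1)"
      using B by (simp add: q)
    also have "\<dots> = 4 * E"
      by (simp only: E_def flip: D)
    finally have "3 * B = 4 * E" .
    \<comment> \<open>The factor \<open>2 * p - 1\<close> is odd except at \<open>p = 0\<close>,
      where truncated subtraction gives 0; there \<open>D\<close> vanishes as well.\<close>
    moreover have "odd E \<longleftrightarrow> odd (q div 4)"
      using parD by (cases "p = 0") (auto simp: E_def q)
    ultimately show ?thesis
      by presburger
  next
    case False
    define t where "t = q div 16"
    have q: "q = 16 * t + 1"
      using False assms by (simp add: t_def) presburger
    have "C = 8 * t * (q - 2)"
      using C by (simp add: q)
    then have "3 * B = 8 * (q * t * (q - 2))"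
      using B by simp
    moreover have "even (q div 4)"
      unfolding q by presburger
    ultimately show ?thesis
      by presburger
  qed
  then show ?thesis
    by (simp add: par B_def)
qed

section \<open>Equidistribution of the Hamming weight modulo M\<close>

lemma card_cube: "card (cube n) = 2 ^ n"
  by (simp add: cube_def card_PiE numeral_2_eq_2)

lemma sum_cube_power_weight:
  fixes z :: "'a :: comm_semiring_1"
  shows "(\<Sum>x\<in>cube n. z ^ hamming_weight n x) = (1 + z) ^ n"
proof -
  have "(\<Sum>x\<in>cube n. z ^ hamming_weight n x) = (\<Sum>x\<in>cube n. \<Prod>i\<in>{1..n}. z ^ x i)"
    by (simp add: hamming_weight_def power_sum)
  also have "\<dots> = (\<Prod>i\<in>{1..n}. \<Sum>b\<in>{0, 1}. z ^ b)"
    unfolding cube_def by (subst prod_sum_PiE) auto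
  also have "\<dots> = (1 + z) ^ n"
    by simp
  finally show ?thesis .
qed

lemma cis_root_of_unity_eq_1_iff:
  assumes "M > 0"
  shows "cis (2 * pi * real a / real M) = 1 \<longleftrightarrow> M dvd a"
proof
  assume "cis (2 * pi * real a / real M) = 1"
  then obtain k :: int where "2 * pi * real a / real M = of_int k * (2 * pi)"
    by (auto simp: cis_eq_1_iff)
  then have "real a = of_int k * real M"
    using assms by (simp add: field_simps)
  then have "int a = k * int M"
    by (metis of_int_eq_iff of_int_mult of_int_of_nat_eq)
  then have "int M dvd int a"
    by simp
  then show "M dvd a"
    by simp
next
  assume "M dvd a"
  then obtain k where "a = M * k"
    by (elim dvdE)
  then show "cis (2 * pi * real a / real M) = 1"
    using assms cis_multiple_2pi[of "real k"] by (simp add: mult.assoc)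
qed

text \<open>Exchanging \<open>j\<close> and \<open>a\<close> in the exponent gives a geometric sum
  whose ratio is an M-th root of unity; it vanishes unless the ratio is 1.\<close>

lemma sum_roots_of_unity_power:
  assumes "M > 0"
  shows "(\<Sum>j<M. cis (2 * pi * real j / real M) ^ a) = (if M dvd a then of_nat M else 0)"
proof -
  let ?z = "cis (2 * pi * real a / real M)"
  have "(\<Sum>j<M. cis (2 * pi * real j / real M) ^ a) = (\<Sum>j<M. ?z ^ j)"
    by (simp add: Complex.DeMoivre mult_ac)
  moreover have "?z ^ M = 1"
    using assms by (simp add: Complex.DeMoivre)
  ultimately show ?thesis
    using cis_root_of_unity_eq_1_iff[OF assms, of a] by (simp add: sum_gp_strict)
qed

text \<open>Equality in the triangle inequality would force the unit vectors 1 and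
  \<open>cis t\<close> to coincide.\<close>

lemma norm_one_plus_cis_less:
  assumes "cis t \<noteq> 1"
  shows "norm (1 + cis t) < 2"
proof -
  have "norm (1 + cis t) \<noteq> norm (1 :: complex) + norm (cis t)"
    using assms by (subst norm_triangle_eq) simp
  then show ?thesis
    using norm_triangle_ineq[of 1 "cis t"] by simp
qed

text \<open>A roots-of-unity filter writes the density as an average over \<open>j\<close> of terms
  with factor ((1 + \<zeta> j) / 2) ^ n; these decay geometrically except at
  \<open>j = 0\<close>.\<close>

lemma cube_weight_mod_equidistributed:
  assumes "r < M"
  shows "(\<lambda>n. real (card {x \<in> cube n. hamming_weight n x mod M = r}) / 2 ^ n)
           \<longlonglongrightarrow> 1 / real M"
proof -
  define \<zeta> where "\<zeta> j = cis (2 * pi * real j / real M)" for j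
  have M: "M > 0"
    using assms by simp
  let ?N = "\<lambda>n. card {x \<in> cube n. hamming_weight n x mod M = r}"
  have count: "complex_of_real (real (?N n) / 2 ^ n)
      = (\<Sum>j<M. \<zeta> j ^ (M - r) * ((1 + \<zeta> j) / 2) ^ n) / of_nat M" for n
  proof -
    \<comment> \<open>The filter would use \<zeta> j to the power w - r; adding M keeps the exponent
      a natural number.\<close>
    have dvd: "M dvd w + (M - r) \<longleftrightarrow> w mod M = r" for w
    proof -
      have "M dvd w + (M - r) \<longleftrightarrow> int M dvd int w - int r + int M * 1"
        using assms by (simp add: of_nat_diff algebra_simps flip: int_dvd_int_iff)
      also have "\<dots> \<longleftrightarrow> int w mod int M = int r mod int M"
        by (subst dvd_add_left_iff) (auto simp: mod_eq_dvd_iff)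
      also have "\<dots> \<longleftrightarrow> w mod M = r"
        using assms by (metis mod_less of_nat_eq_iff zmod_int)
      finally show ?thesis .
    qed
    have "of_nat M * complex_of_nat (?N n)
        = (\<Sum>x\<in>cube n. if hamming_weight n x mod M = r then of_nat M else 0)"
      by (simp add: sum.If_cases finite_cube Int_def)
    also have "\<dots> = (\<Sum>x\<in>cube n. \<Sum>j<M. \<zeta> j ^ (hamming_weight n x + (M - r)))"
      by (simp only: \<zeta>_def sum_roots_of_unity_power[OF M] dvd)
    also have "\<dots> = (\<Sum>j<M. \<zeta> j ^ (M - r) * (\<Sum>x\<in>cube n. \<zeta> j ^ hamming_weight n x))"
      by (subst sum.swap) (simp add: power_add sum_distrib_left mult_ac)
    also have "\<dots> = 2 ^ n * (\<Sum>j<M. \<zeta> j ^ (M - r) * ((1 + \<zeta> j) / 2) ^ n)"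
      by (simp add: sum_cube_power_weight sum_distrib_left power_divide)
    finally show ?thesis
      using M by (simp add: field_simps)
  qed
  have "(\<lambda>n. \<zeta> j ^ (M - r) * ((1 + \<zeta> j) / 2) ^ n) \<longlonglongrightarrow> (if j = 0 then 1 else 0)"
    if "j < M" for j
  proof (cases "j = 0")
    case False
    then have "\<not> M dvd j"
      using that by (auto dest: dvd_imp_le)
    then have "norm ((1 + \<zeta> j) / 2) < 1"
      using norm_one_plus_cis_less cis_root_of_unity_eq_1_iff[OF M, of j]
      by (simp add: \<zeta>_def norm_divide)
    then show ?thesis
      using False by (auto intro!: tendsto_mult_right_zero LIMSEQ_power_zero)
  qed (simp add: \<zeta>_def)
  then have "(\<lambda>n. \<Sum>j<M. \<zeta> j ^ (M - r) * ((1 + \<zeta> j) / 2) ^ n)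
      \<longlonglongrightarrow> (\<Sum>j<M. if j = 0 then 1 else 0)"
    by (intro tendsto_sum) auto
  then have "(\<lambda>n. (\<Sum>j<M. \<zeta> j ^ (M - r) * ((1 + \<zeta> j) / 2) ^ n) / of_nat M)
      \<longlonglongrightarrow> 1 / of_nat M"
    using M by (intro tendsto_divide) (auto simp: sum.delta)
  then have "(\<lambda>n. complex_of_real (real (?N n) / 2 ^ n)) \<longlonglongrightarrow> complex_of_real (1 / real M)"
    by (simp only: count) simp
  then show ?thesis
    by (simp only: tendsto_of_real_iff)
qed

lemma cube_weight_mod_in_tendsto:
  assumes "A \<subseteq> {..<M}"
  shows "(\<lambda>n. real (card {x \<in> cube n. hamming_weight n x mod M \<in> A}) / 2 ^ n)
           \<longlonglongrightarrow> real (card A) / real M"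
proof -
  have fin: "finite A"
    using assms finite_subset by blast
  have "card {x \<in> cube n. hamming_weight n x mod M \<in> A}
      = (\<Sum>r\<in>A. card {x \<in> cube n. hamming_weight n x mod M = r})" for n
  proof -
    have "{x \<in> cube n. hamming_weight n x mod M \<in> A}
        = (\<Union>r\<in>A. {x \<in> cube n. hamming_weight n x mod M = r})"
      by auto
    then show ?thesis
      using fin by (simp only:) (subst card_UN_disjoint, auto simp: finite_cube)
  qed
  moreover have "(\<lambda>n. \<Sum>r\<in>A. real (card {x \<in> cube n. hamming_weight n x mod M = r}) / 2 ^ n)
      \<longlonglongrightarrow> (\<Sum>r\<in>A. 1 / real M)"
    using assms by (intro tendsto_sum cube_weight_mod_equidistributed) auto
  ultimately show ?thesis
    by (simp add: sum_divide_distrib)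
qed

section \<open>Elementary symmetric polynomials as approximants\<close>

text \<open>The count before reduction modulo 2 is needed here, since the approximant is read modulo
  8.\<close>

lemma sum_monomials_cube:
  assumes "x \<in> cube n"
  shows "(\<Sum>I | I \<subseteq> {1..n} \<and> card I = k. \<Prod>i\<in>I. x i) = hamming_weight n x choose k"
proof -
  define A where "A = {i \<in> {1..n}. x i = 1}"
  have x: "x i = of_bool (i \<in> A)" if "i \<in> {1..n}" for i
    using assms that by (force simp: cube_def A_def PiE_iff)
  have A: "A \<subseteq> {1..n}" "finite A"
    by (auto simp: A_def)
  have w: "hamming_weight n x = card A"
  proof -
    have "hamming_weight n x = (\<Sum>i=1..n. of_bool (i \<in> A))"
      unfolding hamming_weight_def by (intro sum.cong refl x)
    also have "\<dots> = card ({1..n} \<inter> A)"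
      by (simp add: Int_def)
    finally show ?thesis
      using A by (simp add: Int_absorb1)
  qed
  have p: "(\<Prod>i\<in>I. x i) = of_bool (I \<subseteq> A)" if "I \<subseteq> {1..n}" for I
  proof -
    have "finite I"
      using that finite_subset by blast
    moreover have "(\<Prod>i\<in>I. x i) = (\<Prod>i\<in>I. of_bool (i \<in> A))"
      using that x by (intro prod.cong) auto
    ultimately show ?thesis
      by (auto simp: subset_iff intro!: prod.neutral)
  qed
  have "(\<Sum>I | I \<subseteq> {1..n} \<and> card I = k. \<Prod>i\<in>I. x i)
      = (\<Sum>I | I \<subseteq> {1..n} \<and> card I = k. of_bool (I \<subseteq> A))"
    using p by (intro sum.cong) auto
  also have "\<dots> = card {I. I \<subseteq> A \<and> card I = k}"
    using A by (simp add: Int_def) (rule arg_cong[where f = card], auto)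
  finally show ?thesis
    using A by (simp add: n_subsets w)
qed

lemma choose_weight_agr_le_gamma:
  assumes "m \<le> d" "k > 0"
  shows "real (card {x \<in> cube n. lift k F x = int (hamming_weight n x choose m) mod 2 ^ k}) / 2 ^ n
           \<le> gamma n d k F"
proof -
  \<comment> \<open>These coefficients select the elementary symmetric polynomial of degree
    \<open>m\<close>; \<open>k > 0\<close> makes 1 a legal residue.\<close>
  define c :: "nat set \<Rightarrow> int" where "c I = of_bool (card I = m)" for I
  define Q where "Q x = (\<Sum>I | I \<subseteq> {1..n} \<and> card I \<le> d. c I * (\<Prod>i\<in>I. int (x i))) mod 2 ^ k"
    for x :: "nat \<Rightarrow> nat"
  have "\<forall>I. c I \<in> {0..<2 ^ k}"
    using assms(2) by (simp add: c_def)
  then have "Q \<in> mpolys n d k"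
    unfolding mpolys_def Q_def by blast
  then have "agr (cube n) (lift k F) Q \<le> gamma n d k F"
    unfolding gamma_def by (intro Max_ge gamma_max_well_defined imageI)
  moreover have "Q x = int (hamming_weight n x choose m) mod 2 ^ k" if "x \<in> cube n" for x
  proof -
    have "(\<Sum>I | I \<subseteq> {1..n} \<and> card I \<le> d. c I * (\<Prod>i\<in>I. int (x i)))
        = (\<Sum>I | I \<subseteq> {1..n} \<and> card I = m. \<Prod>i\<in>I. int (x i))"
      using assms(1) by (intro sum.mono_neutral_cong_right) (auto simp: c_def)
    also have "\<dots> = int (hamming_weight n x choose m)"
      by (simp flip: sum_monomials_cube[OF that])
    finally show ?thesis
      by (simp add: Q_def)
  qed
  then have "cube n \<inter> {x. lift k F x = Q x}
      = {x \<in> cube n. lift k F x = int (hamming_weight n x choose m) mod 2 ^ k}"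
    by auto
  then have "agr (cube n) (lift k F) Q
      = real (card {x \<in> cube n. lift k F x = int (hamming_weight n x choose m) mod 2 ^ k}) / 2 ^ n"
    by (simp add: agr_def measure_pmf_of_set finite_cube cube_nonempty card_cube)
  ultimately show ?thesis
    by simp
qed

section \<open>Density of the agreeing residue classes\<close>

theorem theorem3p1:
  fixes l d :: nat
  assumes "l \<ge> 2" and "d = 2 ^ (l - 1) + 2 ^ (l - 2)"
  shows "\<exists>\<epsilon> :: nat \<Rightarrow> real. \<epsilon> \<longlonglongrightarrow> 0 \<and>
           (\<forall>n\<ge>1. gamma n d 3 (elem_sym n (2 ^ l)) \<ge> 9 / 16 - \<epsilon> n)"
proof -
  define s where "s = l - 2"
  have l: "l = s + 2"
    using assms(1) by (simp add: s_def)
  define m :: nat where "m = 2 ^ s"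
  have m: "m > 0"
    by (simp add: m_def)
  have d: "d = m * 3"
    by (simp add: assms(2) l m_def)
  have l4: "2 ^ l = m * 4"
    by (simp add: l m_def)
  define G :: "nat set" where "G = {0, 1, 2, 4, 6, 8, 10, 12, 14}"
  define A where "A = {t \<in> {..<16 * m}. t div m \<in> G}"
  define p where "p n = real (card {x \<in> cube n. hamming_weight n x mod (16 * m) \<in> A}) / 2 ^ n"
    for n
  \<comment> \<open>Division with remainder by \<open>m\<close>: each quotient in \<open>G\<close>
    accounts for \<open>m\<close> weights modulo \<open>16 * m\<close>.\<close>
  have "bij_betw (\<lambda>(q, r). q * m + r) (G \<times> {..<m}) A"
  proof (rule bij_betwI[where g = "\<lambda>t. (t div m, t mod m)"])
    show "(\<lambda>(q, r). q * m + r) \<in> G \<times> {..<m} \<rightarrow> A"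
    proof (clarsimp simp: A_def)
      fix q r
      assume "q \<in> G" "r < m"
      then have "Suc q * m \<le> 16 * m"
        by (intro mult_right_mono) (auto simp: G_def)
      then show "q * m + r < 16 * m"
        using \<open>r < m\<close> unfolding mult_Suc by linarith
    qed
  qed (use m in \<open>auto simp: A_def\<close>)
  then have "card A = card (G \<times> {..<m})"
    by (simp add: bij_betw_same_card)
  then have "card A = 9 * m"
    by (simp add: G_def)
  then have "real (card A) / real (16 * m) = 9 / 16"
    using m by simp
  moreover have "p \<longlonglongrightarrow> real (card A) / real (16 * m)"
    unfolding p_def by (rule cube_weight_mod_in_tendsto) (auto simp: A_def)
  ultimately have lim: "p \<longlonglongrightarrow> 9 / 16"
    by (simp only:)
  have agree: "lift 3 (elem_sym n (2 ^ l)) x = int (hamming_weight n x choose d) mod 2 ^ 3"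
    if x: "x \<in> cube n" and w: "hamming_weight n x mod (16 * m) \<in> A" for n x
  proof -
    define w where "w = hamming_weight n x"
    define q where "q = w div m"
    \<comment> \<open>Reducing the weight modulo \<open>16 * m\<close> still determines its quotient
      by \<open>m\<close> modulo 16.\<close>
    have "q mod 16 = w mod (16 * m) div m"
      using m by (simp add: q_def mod_mult2_eq mult.commute[of 16])
    then have "q mod 16 \<in> G"
      using w by (simp add: A_def w_def)
    then have "even (q mod 16) \<or> q mod 16 = 1"
      by (auto simp: G_def)
    then have q: "even q \<or> q mod 16 = 1"
      by presburger
    have q3: "(q choose 3) mod 8 = (if odd (q choose 4) then 4 else 0)"
      by (rule choose_3_mod8[OF q])
    then have "4 dvd (q choose 3)"
      by presburger
    then have "(w choose d) mod 8 = (if odd (q choose 4) then 4 else 0)"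
      using choose_pow2_mult_right_mod8[of w s 3] q3 by (simp add: d q_def m_def)
    moreover have "odd (w choose 2 ^ l) \<longleftrightarrow> odd (q choose 4)"
      using odd_choose_pow2_mult_right[of w s 4] by (simp only: l4 q_def m_def)
    ultimately have "(w choose d) mod 8 = (if odd (w choose 2 ^ l) then 4 else 0)"
      by simp
    then have "int (w choose d) mod 8 = (if odd (w choose 2 ^ l) then 4 else 0)"
      by (metis of_nat_0 of_nat_mod of_nat_numeral)
    then show ?thesis
      by (simp add: lift_def elem_sym_eq_binomial[OF x] w_def even_iff_mod_2_eq_zero)
  qed
  have "p n \<le> gamma n d 3 (elem_sym n (2 ^ l))" for n
  proof -
    have "p n \<le> real (card {x \<in> cube n. lift 3 (elem_sym n (2 ^ l)) x
        = int (hamming_weight n x choose d) mod 2 ^ 3}) / 2 ^ n"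
      unfolding p_def using agree
      by (intro divide_right_mono of_nat_mono card_mono) (auto simp: finite_cube)
    also have "\<dots> \<le> gamma n d 3 (elem_sym n (2 ^ l))"
      by (rule choose_weight_agr_le_gamma) auto
    finally show ?thesis .
  qed
  moreover have "(\<lambda>n. 9 / 16 - p n) \<longlonglongrightarrow> 0"
    using tendsto_diff[OF tendsto_const lim, of "9 / 16"] by simp
  ultimately show ?thesis
    \<comment> \<open>With this error term, which may be negative, the claimed bound is exactly
      \<open>p n \<le> gamma\<close>.\<close>
    by (intro exI[of _ "\<lambda>n. 9 / 16 - p n"]) simp
qed

end
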